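(* For $n\geq 1$ and $m\geq 2$, the maximum forcing number of $T(2n+1,2m)$ is $F(T(2n+1,2m))=(n+1)m$.
   Context: $T(2n+1,2m)$ is the graph with vertices $(u_i,v_j)$, $i\in\mathbb{Z}_{2m}$, $j\in\mathbb{Z}_{2n+1}$, where $(u_i,v_j)$ is adjacent to $(u_{i+1},v_j)$ and to $(u_i,v_{j+1})$ (the grid graph of the quadriculated torus). For a perfect matching $M$ of a graph $G$, a subset $S\subseteq M$ is a forcing set of $M$ if no other perfect matching of $G$ contains $S$; the forcing number $f(G,M)$ is the minimum size of a forcing set of $M$. The maximum forcing number $F(G)$ is the maximum of $f(G,M)$ over all perfect matchings $M$ of $G$. *)

theory Defs
  imports Main
begin

(* A (simple) graph is given by a vertex set V and an edge set E of 2-element subsets of V. *)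

definition perfect_matching :: "'a set \<Rightarrow> 'a set set \<Rightarrow> 'a set set \<Rightarrow> bool" where
  "perfect_matching V E M \<longleftrightarrow> M \<subseteq> E \<and> (\<forall>v\<in>V. \<exists>!e. e \<in> M \<and> v \<in> e)"

definition forcing_set :: "'a set \<Rightarrow> 'a set set \<Rightarrow> 'a set set \<Rightarrow> 'a set set \<Rightarrow> bool" where
  "forcing_set V E M S \<longleftrightarrow> S \<subseteq> M \<and>
     (\<forall>M'. perfect_matching V E M' \<and> S \<subseteq> M' \<longrightarrow> M' = M)"

definition forcing_number :: "'a set \<Rightarrow> 'a set set \<Rightarrow> 'a set set \<Rightarrow> nat" where
  "forcing_number V E M = (LEAST k. \<exists>S. forcing_set V E M S \<and> card S = k)"

definition max_forcing_number :: "'a set \<Rightarrow> 'a set set \<Rightarrow> nat" where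
  "max_forcing_number V E = Max {forcing_number V E M | M. perfect_matching V E M}"

(* The quadriculated torus T(2n+1,2m): vertices (u_i, v_j) encoded as (i,j),
   i in Z_{2m}, j in Z_{2n+1}. *)
definition torus_V :: "nat \<Rightarrow> nat \<Rightarrow> (nat \<times> nat) set" where
  "torus_V n m = {0..<2*m} \<times> {0..<2*n+1}"

definition torus_E :: "nat \<Rightarrow> nat \<Rightarrow> (nat \<times> nat) set set" where
  "torus_E n m =
     {{(i, j), ((i + 1) mod (2*m), j)} | i j. i < 2*m \<and> j < 2*n+1} \<union>
     {{(i, j), (i, (j + 1) mod (2*n+1))} | i j. i < 2*m \<and> j < 2*n+1}"

end

theory Submission
  imports Defs
begin

text \<open>Lower bound: in the matching by the edges \<open>(2c, j)(2c+1, j)\<close>, two edges with consecutive \<open>j\<close>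
  span an alternating 4-cycle, so a forcing set meets every pair of columns in a vertex cover of
  an odd cycle of length \<open>2n+1\<close>, hence in at least \<open>n+1\<close> edges.

  Upper bound: fix an independent set of \<open>nm\<close> marked vertices, \<open>n\<close> in each odd column, whose rows
  alternate in parity from one odd column to the next (up to one exceptional neighbouring pair when \<open>m\<close> is
  odd). For every perfect matching \<open>M\<close>, the \<open>(n+1)m\<close> edges that avoid the marked vertices force \<open>M\<close>:
  otherwise some permutation moves marked vertices along alternating cycles, by steps of length 2. Such a
  cycle cannot stay within one column, as it would have to come back through the vertices it has used,
  so it runs up one column of the exceptional pair and down the other. But then it encloses
  an odd number of vertices of the column in between, which \<open>M\<close> cannot match among themselves.\<close>

section \<open>Perfect matchings of simple graphs and mates\<close>

definition simple_graph :: "'a set \<Rightarrow> 'a set set \<Rightarrow> bool" where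
  "simple_graph V E \<longleftrightarrow> finite V \<and> (\<forall>e\<in>E. e \<subseteq> V \<and> card e = 2)"

definition mate :: "'a set set \<Rightarrow> 'a \<Rightarrow> 'a" where
  "mate M v = (THE w. {v, w} \<in> M)"

lemma simple_graph_edge_cases:
  assumes "simple_graph V E" "e \<in> E"
  obtains a b where "e = {a, b}" "a \<noteq> b" "a \<in> V" "b \<in> V"
  using assms unfolding simple_graph_def by (metis card_2_iff insert_subset)

lemma finite_edges: "simple_graph V E \<Longrightarrow> finite E"
  unfolding simple_graph_def by (meson PowI finite_Pow_iff finite_subset subsetI)

lemma matching_edge_unique:
  assumes "perfect_matching V E M" "v \<in> V" "e \<in> M" "v \<in> e" "e' \<in> M" "v \<in> e'"
  shows "e = e'"
  using assms unfolding perfect_matching_def by blast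

lemma mate_eqI:
  assumes "simple_graph V E" "perfect_matching V E M" "{v, w} \<in> M"
  shows "mate M v = w"
proof -
  have ME: "M \<subseteq> E" using assms(2) by (simp add: perfect_matching_def)
  then have v: "v \<in> V" using assms unfolding simple_graph_def by blast
  show ?thesis unfolding mate_def
  proof (rule the_equality)
    show "{v, w} \<in> M" by fact
    fix u assume "{v, u} \<in> M"
    then have "{v, u} = {v, w}"
      using matching_edge_unique[OF assms(2) v] assms(3) by blast
    then show "u = w" by (metis doubleton_eq_iff)
  qed
qed

lemma mate_edge:
  assumes "simple_graph V E" "perfect_matching V E M" "v \<in> V"
  shows "{v, mate M v} \<in> M"
proof -
  obtain e where e: "e \<in> M" "v \<in> e" using assms unfolding perfect_matching_def by blast
  moreover from e(1) have "e \<in> E" using assms(2) unfolding perfect_matching_def by blast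
  ultimately obtain w where "e = {v, w}"
    using simple_graph_edge_cases[OF assms(1), of e] by (metis insertE insert_commute singletonD)
  then show ?thesis using e mate_eqI[OF assms(1,2)] by metis
qed

lemma mate_props:
  assumes "simple_graph V E" "perfect_matching V E M" "v \<in> V"
  shows "mate M v \<in> V" "mate M v \<noteq> v" "mate M (mate M v) = v" "{v, mate M v} \<in> E"
proof -
  show E: "{v, mate M v} \<in> E"
    using mate_edge[OF assms] assms(2) unfolding perfect_matching_def by blast
  then show "mate M v \<in> V" "mate M v \<noteq> v"
    using assms(1) unfolding simple_graph_def by (auto simp: card_insert_if split: if_splits)
  show "mate M (mate M v) = v"
    using mate_eqI[OF assms(1,2)] mate_edge[OF assms] by (metis insert_commute)
qed

lemma matching_edge_mate:
  assumes "simple_graph V E" "perfect_matching V E M" "e \<in> M" "v \<in> e"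
  shows "e = {v, mate M v}"
proof -
  have "v \<in> V" using assms unfolding simple_graph_def perfect_matching_def by blast
  then show ?thesis using matching_edge_unique[OF assms(2)] mate_edge[OF assms(1,2)] assms by blast
qed

text \<open>A vertex of an edge of \<open>M'\<close> lies on an edge of \<open>M\<close>, hence of
  \<open>M'\<close>, and by uniqueness the two edges coincide.\<close>

lemma perfect_matching_subset_eq:
  assumes "simple_graph V E" "perfect_matching V E M" "perfect_matching V E M'" "M \<subseteq> M'"
  shows "M = M'"
proof -
  have "e \<in> M" if "e \<in> M'" for e
  proof -
    have "e \<in> E" using that assms(3) unfolding perfect_matching_def by blast
    then obtain v where v: "v \<in> e" "v \<in> V" using simple_graph_edge_cases[OF assms(1)] by blast
    then have "{v, mate M v} \<in> M'" using mate_edge[OF assms(1,2)] assms(4) by blast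
    then have "e = {v, mate M v}" using matching_edge_unique[OF assms(3) v(2) that v(1)] by blast
    then show ?thesis using mate_edge[OF assms(1,2) v(2)] by simp
  qed
  then show ?thesis using assms(4) by blast
qed

lemma forcing_set_self:
  assumes "simple_graph V E" "perfect_matching V E M"
  shows "forcing_set V E M M"
  unfolding forcing_set_def using perfect_matching_subset_eq[OF assms] by blast

section \<open>Forcing sets, edge counts and alternating cycles\<close>

lemma forcing_number_le:
  assumes "forcing_set V E M S"
  shows "forcing_number V E M \<le> card S"
  unfolding forcing_number_def by (rule Least_le) (use assms in blast)

text \<open>\<open>M\<close> itself is forcing, so the minimum is attained.\<close>

lemma forcing_number_witness:
  assumes "simple_graph V E" "perfect_matching V E M"
  obtains S where "forcing_set V E M S" "card S = forcing_number V E M"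
  using LeastI[of "\<lambda>k. \<exists>S. forcing_set V E M S \<and> card S = k" "card M"]
    forcing_set_self[OF assms] unfolding forcing_number_def by blast

lemma card_perfect_matching:
  assumes "simple_graph V E" "perfect_matching V E M"
  shows "card V = 2 * card M"
proof -
  have sub: "M \<subseteq> E" using assms(2) by (simp add: perfect_matching_def)
  then have V: "\<Union>M = V"
    using assms mate_edge[OF assms] unfolding simple_graph_def by blast
  have "card (\<Union>M) = (\<Sum>e\<in>M. card e)"
  proof (rule card_Union_disjoint)
    show "pairwise disjnt M"
      unfolding pairwise_def disjnt_def
      using matching_edge_unique[OF assms(2)] V by blast
    show "\<And>e. e \<in> M \<Longrightarrow> finite e"
      using sub assms(1) unfolding simple_graph_def by (meson finite_subset subsetD)
  qed
  also have "\<dots> = (\<Sum>e\<in>M. 2)"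
    using sub assms(1) unfolding simple_graph_def by (intro sum.cong) auto
  finally show ?thesis using V by simp
qed

text \<open>A matching edge contains at most one vertex of the independent set \<open>X\<close>, so
  exactly \<open>card X\<close> edges of \<open>M\<close> meet it.\<close>

lemma card_matching_avoiding:
  assumes "simple_graph V E" "perfect_matching V E M" "X \<subseteq> V"
    and indep: "\<And>x y. x \<in> X \<Longrightarrow> y \<in> X \<Longrightarrow> {x, y} \<notin> E"
  shows "card {e \<in> M. e \<inter> X = {}} + card X = card M"
proof -
  have finM: "finite M"
    using finite_edges[OF assms(1)] assms(2) unfolding perfect_matching_def
    by (meson finite_subset)
  have inj: "inj_on (\<lambda>x. {x, mate M x}) X"
  proof (rule inj_onI)
    fix x y assume xy: "x \<in> X" "y \<in> X" "{x, mate M x} = {y, mate M y}"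
    then have "x = y \<or> mate M x = y" by (metis doubleton_eq_iff)
    then show "x = y"
      using indep[OF xy(1,2)] mate_props(4)[OF assms(1,2)] xy assms(3) by auto
  qed
  have "{e \<in> M. e \<inter> X \<noteq> {}} = (\<lambda>x. {x, mate M x}) ` X" (is "?L = ?R")
  proof
    show "?L \<subseteq> ?R" using matching_edge_mate[OF assms(1,2)] by blast
    show "?R \<subseteq> ?L" using mate_edge[OF assms(1,2)] assms(3) by blast
  qed
  then have "card {e \<in> M. e \<inter> X \<noteq> {}} = card X" using inj by (simp add: card_image)
  moreover have "card M = card {e \<in> M. e \<inter> X = {}} + card {e \<in> M. e \<inter> X \<noteq> {}}"
    using finM by (subst card_Un_disjoint[symmetric]) (auto intro: arg_cong[where f = card])
  ultimately show ?thesis by simp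
qed

text \<open>Since \<open>X\<close> is independent, a second perfect matching \<open>M'\<close> containing the edges of \<open>M\<close> that
  avoid \<open>X\<close> also matches \<open>X\<close> onto the \<open>M\<close>-mates of \<open>X\<close>; following \<open>M\<close> and then \<open>M'\<close> runs
  along alternating cycles.\<close>

lemma not_forcing_permutation:
  assumes sg: "simple_graph V E" and pm: "perfect_matching V E M" and XV: "X \<subseteq> V"
    and indep: "\<And>x y. x \<in> X \<Longrightarrow> y \<in> X \<Longrightarrow> {x, y} \<notin> E"
    and nf: "\<not> forcing_set V E M {e \<in> M. e \<inter> X = {}}"
  obtains D f where "D \<noteq> {}" "D \<subseteq> X" "bij_betw f D D"
    "\<And>x. x \<in> D \<Longrightarrow> f x \<noteq> x" "\<And>x. x \<in> D \<Longrightarrow> {mate M x, f x} \<in> E"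
proof -
  obtain M' where pm': "perfect_matching V E M'" and sub: "{e \<in> M. e \<inter> X = {}} \<subseteq> M'"
    and ne: "M' \<noteq> M"
    using nf unfolding forcing_set_def by blast
  let ?g = "mate M" and ?h = "mate M'"
  note g = mate_props[OF sg pm] and h = mate_props[OF sg pm']
  have finX: "finite X" using XV sg unfolding simple_graph_def by (meson finite_subset)
  have gX: "?g x \<notin> X" if "x \<in> X" for x using indep[OF that] g(4) that XV by blast
  have hX: "?h x \<notin> X" if "x \<in> X" for x using indep[OF that] h(4) that XV by blast
  have agree: "?g v = ?h v" if "v \<in> V" "v \<notin> X" "?g v \<notin> X" for v
  proof -
    have "{v, ?g v} \<in> M'" using mate_edge[OF sg pm that(1)] that sub by blast
    then show ?thesis using mate_eqI[OF sg pm'] by metis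
  qed
  \<comment> \<open>If the \<open>M\<close>-mate of \<open>y\<close> were outside \<open>X\<close>,
    the matchings would agree at \<open>y\<close>, yet its \<open>M'\<close>-mate lies in
    \<open>X\<close>.\<close>
  have hXY: "?h ` X \<subseteq> ?g ` X"
  proof
    fix y assume "y \<in> ?h ` X"
    then obtain x where x: "x \<in> X" "y = ?h x" by blast
    have xV: "x \<in> V" using x XV by blast
    have y: "y \<in> V" "?h y = x" "y \<notin> X" using h[OF xV] x hX by auto
    have "?g y \<in> X" using agree[OF y(1,3)] y(2) x(1) by metis
    then show "y \<in> ?g ` X" using g(3)[OF y(1)] by (metis image_eqI)
  qed
  have injg: "inj_on ?g V" using g(3) by (metis inj_onI)
  have injh: "inj_on ?h V" using h(3) by (metis inj_onI)
  have eq: "?h ` X = ?g ` X"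
  proof (rule card_subset_eq[OF _ hXY])
    show "finite (?g ` X)" using finX by simp
    show "card (?h ` X) = card (?g ` X)"
      using injg injh XV by (metis card_image inj_on_subset)
  qed
  define D where "D = {x \<in> X. ?g x \<noteq> ?h x}"
  define f where "f = ?h \<circ> ?g"
  have DV: "D \<subseteq> V" and DX: "D \<subseteq> X" using XV unfolding D_def by auto
  have fD: "f x \<in> D \<and> f x \<noteq> x \<and> {?g x, f x} \<in> E" if x: "x \<in> D" for x
  proof -
    have xX: "x \<in> X" and xV: "x \<in> V" and xne: "?g x \<noteq> ?h x" using x XV unfolding D_def by auto
    obtain z where z: "z \<in> X" "?g x = ?h z" using eq xX by blast
    have zV: "z \<in> V" using z XV by blast
    have fz: "f x = z" using z h(3)[OF zV] unfolding f_def by simp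
    have "z \<noteq> x" using z xne by auto
    moreover have "?g z \<noteq> ?h z" using z \<open>z \<noteq> x\<close> injg xV zV by (metis inj_onD)
    moreover have "{?g x, f x} \<in> E" using h(4)[OF g(1)[OF xV]] unfolding f_def by simp
    ultimately show ?thesis using fz z unfolding D_def by simp
  qed
  have "inj_on f D"
    unfolding f_def
  proof (rule comp_inj_on)
    show "inj_on ?g D" using injg DV by (rule inj_on_subset)
    show "inj_on ?h (?g ` D)" by (rule inj_on_subset[OF injh]) (use g(1) DV in blast)
  qed
  moreover have "finite D" using finX DX finite_subset by blast
  ultimately have bij: "bij_betw f D D"
    using fD by (intro bij_betw_imageI endo_inj_surj) auto
  have "D \<noteq> {}"
  proof
    assume "D = {}"
    then have same: "?g x = ?h x" if "x \<in> X" for x using that unfolding D_def by blast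
    have "e \<in> M'" if e: "e \<in> M" for e
    proof (cases "e \<inter> X = {}")
      case True
      then show ?thesis using e sub by blast
    next
      case False
      then obtain x where x: "x \<in> e" "x \<in> X" by blast
      then show ?thesis
        using matching_edge_mate[OF sg pm e x(1)] same[OF x(2)] mate_edge[OF sg pm'] XV by auto
    qed
    then have "M = M'" using perfect_matching_subset_eq[OF sg pm pm'] by blast
    then show False using ne by simp
  qed
  then show thesis using that[of D f] DX bij fD by blast
qed

text \<open>Turns the alternating 4-cycle through \<open>a\<close>, \<open>b\<close>,
  \<open>d\<close>, \<open>c\<close>.\<close>

lemma perfect_matching_swap:
  assumes sg: "simple_graph V E" and pm: "perfect_matching V E M"
    and "{a, b} \<in> M" "{c, d} \<in> M" "{a, b} \<noteq> {c, d}" "{a, c} \<in> E" "{b, d} \<in> E"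
  shows "perfect_matching V E (M - {{a, b}, {c, d}} \<union> {{a, c}, {b, d}})" (is "perfect_matching V E ?M")
proof -
  have ME: "M \<subseteq> E" using pm by (simp add: perfect_matching_def)
  have V: "a \<in> V" "b \<in> V" "c \<in> V" "d \<in> V"
    using assms ME unfolding simple_graph_def by blast+
  note u = matching_edge_unique[OF pm]
  have "card {a, b} = 2" "card {c, d} = 2" using assms(3,4) ME sg unfolding simple_graph_def by blast+
  then have ne: "a \<noteq> b" "c \<noteq> d" by auto
  have d: "a \<noteq> c" "a \<noteq> d" "b \<noteq> c" "b \<noteq> d"
    using u[OF V(1)] u[OF V(2)] assms(3-5) by blast+
  have "\<exists>!e. e \<in> ?M \<and> v \<in> e" if v: "v \<in> V" for v
  proof (cases "v \<in> {a, b, c, d}")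
    case True
    have "\<And>e. e \<in> M - {{a, b}, {c, d}} \<Longrightarrow> v \<notin> e"
      using u[OF V(1) assms(3)] u[OF V(2) assms(3)] u[OF V(3) assms(4)] u[OF V(4) assms(4)] True
      by blast
    then show ?thesis using True d ne by auto
  next
    case False
    obtain e where e: "e \<in> M" "v \<in> e" "\<And>e'. e' \<in> M \<Longrightarrow> v \<in> e' \<Longrightarrow> e' = e"
      using pm v unfolding perfect_matching_def by metis
    show ?thesis
    proof (rule ex1I[of _ e])
      show "e \<in> ?M \<and> v \<in> e" using e(1,2) False by blast
      show "e' = e" if "e' \<in> ?M \<and> v \<in> e'" for e' using that e(3) False by blast
    qed
  qed
  moreover have "?M \<subseteq> E" using ME assms(6,7) by auto
  ultimately show ?thesis unfolding perfect_matching_def by simp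
qed

text \<open>A permutation mapping the finite set \<open>?A\<close> into itself would already fill
  \<open>?A\<close>, leaving no room for \<open>f x\<close>, which comes from outside.\<close>

lemma cut_crossed_back:
  assumes "finite D" "bij_betw f D D" "x \<in> D" "\<not> P x" "P (f x)"
  obtains y where "y \<in> D" "P y" "\<not> P (f y)"
proof -
  let ?A = "{y \<in> D. P y}"
  have inj: "inj_on f D" and im: "f ` D = D" using assms(2) by (auto simp: bij_betw_def)
  have "\<not> f ` ?A \<subseteq> ?A"
  proof
    assume "f ` ?A \<subseteq> ?A"
    moreover have "inj_on f ?A" using inj by (rule inj_on_subset) blast
    ultimately have "f ` ?A = ?A" using assms(1) by (intro endo_inj_surj) auto
    moreover have "f x \<in> ?A" using assms im by blast
    ultimately obtain y where "y \<in> ?A" "f x = f y" by (metis (lifting) imageE)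
    then show False using inj assms(3,4) by (auto dest: inj_onD)
  qed
  then show thesis using that im by blast
qed

section \<open>Adjacency in the torus\<close>

lemma torus_E_iff:
  "{(a, b), (c, d)} \<in> torus_E n m \<longleftrightarrow>
     a < 2*m \<and> b < 2*n+1 \<and> c < 2*m \<and> d < 2*n+1 \<and>
     (b = d \<and> (c = (a+1) mod (2*m) \<or> a = (c+1) mod (2*m)) \<or>
      a = c \<and> (d = (b+1) mod (2*n+1) \<or> b = (d+1) mod (2*n+1)))"
  unfolding torus_E_def by (auto simp: doubleton_eq_iff)

lemma Suc_mod_eq_if: "a < k \<Longrightarrow> Suc a mod k = (if Suc a = k then 0 else Suc a)"
  by auto

text \<open>Resolves the modular sums into wrap-around cases, so that later arguments reduce to
  linear arithmetic.\<close>

lemma torus_neighbourD: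
  assumes "{(a, b), (c, d)} \<in> torus_E n m"
  shows "a < 2*m" "b < 2*n+1" "c < 2*m" "d < 2*n+1"
    "b = d \<and> (c = a + 1 \<or> a = c + 1 \<or> a + 1 = 2*m \<and> c = 0 \<or> c + 1 = 2*m \<and> a = 0) \<or>
     a = c \<and> (d = b + 1 \<or> b = d + 1 \<or> b = 2*n \<and> d = 0 \<or> d = 2*n \<and> b = 0)"
  using assms unfolding torus_E_iff by (auto simp: Suc_mod_eq_if split: if_splits)

lemma simple_graph_torus:
  assumes "n \<ge> 1" "m \<ge> 2"
  shows "simple_graph (torus_V n m) (torus_E n m)"
proof -
  have "e \<subseteq> torus_V n m \<and> card e = 2" if "e \<in> torus_E n m" for e
  proof -
    from that obtain a b c d where e: "e = {(a, b), (c, d)}" unfolding torus_E_def by blast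
    have "(a, b) \<noteq> (c, d)" "a < 2*m" "b < 2*n+1" "c < 2*m" "d < 2*n+1"
      using torus_neighbourD[OF that[unfolded e]] assms by auto
    then show ?thesis unfolding e torus_V_def by auto
  qed
  then show ?thesis unfolding simple_graph_def torus_V_def by auto
qed

lemma card_torus_V: "card (torus_V n m) = 2 * ((2*n+1) * m)"
  unfolding torus_V_def by simp

section \<open>Lower bound: the matching of horizontal edges\<close>

definition horizontal_edge :: "nat \<times> nat \<Rightarrow> (nat \<times> nat) set" where
  "horizontal_edge = (\<lambda>(c, j). {(2*c, j), (2*c+1, j)})"

definition horizontal_matching :: "nat \<Rightarrow> nat \<Rightarrow> (nat \<times> nat) set set" where
  "horizontal_matching n m = horizontal_edge ` ({..<m} \<times> {..<2*n+1})"

lemma horizontal_edge_inj: "inj horizontal_edge"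
  unfolding horizontal_edge_def by (auto simp: inj_on_def doubleton_eq_iff)

lemma mem_horizontal_edge: "(i, j) \<in> horizontal_edge (c, k) \<longleftrightarrow> c = i div 2 \<and> k = j"
  unfolding horizontal_edge_def by auto

lemma perfect_matching_horizontal:
  "perfect_matching (torus_V n m) (torus_E n m) (horizontal_matching n m)"
proof -
  have "horizontal_edge (c, j) \<in> torus_E n m" if "c < m" "j < 2*n+1" for c j
    using that unfolding horizontal_edge_def by (simp add: torus_E_iff)
  moreover have "\<exists>!e. e \<in> horizontal_matching n m \<and> (i, j) \<in> e" if "i < 2*m" "j < 2*n+1" for i j
    by (rule ex1I[of _ "horizontal_edge (i div 2, j)"])
      (use that in \<open>auto simp: horizontal_matching_def mem_horizontal_edge\<close>)
  ultimately show ?thesis unfolding perfect_matching_def horizontal_matching_def torus_V_def by auto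
qed

text \<open>If \<open>S\<close> missed both edges, it would also lie in \<open>?M'\<close>, obtained
  by turning the alternating 4-cycle they span.\<close>

lemma forcing_set_horizontal_cover:
  assumes nm: "n \<ge> 1" "m \<ge> 2"
    and S: "forcing_set (torus_V n m) (torus_E n m) (horizontal_matching n m) S"
    and "c < m" "j < 2*n+1"
  shows "horizontal_edge (c, j) \<in> S \<or> horizontal_edge (c, (j+1) mod (2*n+1)) \<in> S"
proof (rule ccontr)
  assume neg: "\<not> ?thesis"
  let ?k = "(j+1) mod (2*n+1)"
  let ?M = "horizontal_matching n m"
  let ?M' = "?M - {horizontal_edge (c, j), horizontal_edge (c, ?k)}
               \<union> {{(2*c, j), (2*c, ?k)}, {(2*c+1, j), (2*c+1, ?k)}}"
  have k: "?k < 2*n+1" "?k \<noteq> j" using nm assms(5) by (auto simp: Suc_mod_eq_if)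
  have "perfect_matching (torus_V n m) (torus_E n m) ?M'"
    unfolding horizontal_edge_def prod.case
  proof (rule perfect_matching_swap[OF simple_graph_torus[OF nm] perfect_matching_horizontal])
    show "{(2*c, j), (2*c+1, j)} \<in> ?M" "{(2*c, ?k), (2*c+1, ?k)} \<in> ?M"
      using k assms(4,5) unfolding horizontal_matching_def horizontal_edge_def by auto
    show "{(2*c, j), (2*c+1, j)} \<noteq> {(2*c, ?k), (2*c+1, ?k)}"
      using k by (auto simp: doubleton_eq_iff)
    show "{(2*c, j), (2*c, ?k)} \<in> torus_E n m" "{(2*c+1, j), (2*c+1, ?k)} \<in> torus_E n m"
      using k assms(4,5) by (auto simp: torus_E_iff)
  qed
  moreover have "S \<subseteq> ?M'" using S neg unfolding forcing_set_def by blast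
  ultimately have "?M' = ?M" using S unfolding forcing_set_def by blast
  then have "{(2*c, j), (2*c, ?k)} \<in> ?M" by blast
  then show False using k unfolding horizontal_matching_def horizontal_edge_def
    by (auto simp: doubleton_eq_iff)
qed

text \<open>\<open>J\<close> and the set \<open>?K\<close> of its cyclic predecessors cover all
  residues, and \<open>?K\<close> is no larger than \<open>J\<close>; so twice \<open>card J\<close>
  is at least the odd number \<open>2*n+1\<close>.\<close>

lemma card_cyclic_vertex_cover:
  assumes "J \<subseteq> {..<2*n+1}" and cover: "\<And>j. j < 2*n+1 \<Longrightarrow> j \<in> J \<or> (j+1) mod (2*n+1) \<in> J"
  shows "n + 1 \<le> card J"
proof -
  let ?N = "2*n+1"
  have finJ: "finite J" using assms(1) finite_subset by blast
  let ?K = "{j. j < ?N \<and> (j+1) mod ?N \<in> J}"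
  have "inj_on (\<lambda>j. (j+1) mod ?N) ?K"
    by (rule inj_onI) (auto simp: Suc_mod_eq_if split: if_splits)
  then have K: "card ?K \<le> card J" by (rule card_inj_on_le) (use finJ in auto)
  have "{..<?N} \<subseteq> J \<union> ?K" using cover by auto
  then have "card {..<?N} \<le> card (J \<union> ?K)" by (rule card_mono[rotated]) (use finJ in auto)
  also have "\<dots> \<le> card J + card ?K" by (rule card_Un_le)
  finally show ?thesis using K by simp
qed

lemma forcing_number_horizontal_ge:
  assumes nm: "n \<ge> 1" "m \<ge> 2"
  shows "(n + 1) * m \<le> forcing_number (torus_V n m) (torus_E n m) (horizontal_matching n m)"
proof -
  obtain S where S: "forcing_set (torus_V n m) (torus_E n m) (horizontal_matching n m) S"
    and card_S: "card S = forcing_number (torus_V n m) (torus_E n m) (horizontal_matching n m)"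
    using forcing_number_witness[OF simple_graph_torus[OF nm] perfect_matching_horizontal] by metis
  \<comment> \<open>The sets \<open>J c\<close> index disjoint parts of \<open>S\<close>, one for
    each pair of columns.\<close>
  define J where "J c = {j. j < 2*n+1 \<and> horizontal_edge (c, j) \<in> S}" for c
  have fin: "finite S"
    using S unfolding forcing_set_def horizontal_matching_def by (meson finite_SigmaI finite_imageI finite_lessThan finite_subset)
  have "n + 1 \<le> card (J c)" if "c < m" for c
    by (rule card_cyclic_vertex_cover)
      (use forcing_set_horizontal_cover[OF nm S that] in \<open>auto simp: J_def\<close>)
  then have "(\<Sum>c<m. n + 1) \<le> (\<Sum>c<m. card (J c))" by (intro sum_mono) auto
  also have "\<dots> = card (Sigma {..<m} J)" by (simp add: J_def)
  also have "\<dots> = card (horizontal_edge ` Sigma {..<m} J)"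
    by (rule card_image[symmetric]) (rule inj_on_subset[OF horizontal_edge_inj], simp)
  also have "\<dots> \<le> card S" by (rule card_mono[OF fin]) (auto simp: J_def)
  finally show ?thesis using card_S by (simp add: mult.commute)
qed

section \<open>Upper bound: marked vertices and their alternating cycles\<close>

text \<open>Moves the permutation from vertices to indices, so that cuts can later be stated by
  column and height.\<close>

lemma not_forcing_permutation_indexed:
  assumes sg: "simple_graph V E" and pm: "perfect_matching V E M"
    and x: "inj_on x I" "x ` I \<subseteq> V"
    and indep: "\<And>p q. p \<in> I \<Longrightarrow> q \<in> I \<Longrightarrow> {x p, x q} \<notin> E"
    and nf: "\<not> forcing_set V E M {e \<in> M. e \<inter> x ` I = {}}"
  obtains D f where "D \<noteq> {}" "D \<subseteq> I" "bij_betw f D D"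
    "\<And>p. p \<in> D \<Longrightarrow> f p \<noteq> p" "\<And>p. p \<in> D \<Longrightarrow> {mate M (x p), x (f p)} \<in> E"
proof -
  obtain D f where D: "D \<noteq> {}" "D \<subseteq> x ` I" and f: "bij_betw f D D"
    "\<And>v. v \<in> D \<Longrightarrow> f v \<noteq> v" "\<And>v. v \<in> D \<Longrightarrow> {mate M v, f v} \<in> E"
    using not_forcing_permutation[OF sg pm x(2) _ nf] indep by blast
  let ?D = "{p \<in> I. x p \<in> D}" and ?f = "\<lambda>p. the_inv_into I x (f (x p))"
  have bx: "bij_betw x ?D D" using x(1) D(2) by (auto simp: bij_betw_def inj_on_def)
  have x_f: "x (?f p) = f (x p) \<and> ?f p \<in> I" if "p \<in> ?D" for p
  proof -
    have "f (x p) \<in> D" using that f(1) by (auto simp: bij_betw_def)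
    then have "f (x p) \<in> x ` I" using D(2) by blast
    then show ?thesis by (simp add: f_the_inv_into_f[OF x(1)] the_inv_into_into[OF x(1)])
  qed
  have "?f ` ?D \<subseteq> ?D" using x_f f(1) by (auto simp: bij_betw_def)
  moreover have "bij_betw (x \<circ> ?f) ?D D"
    by (rule bij_betw_cong[THEN iffD1, OF _ bij_betw_trans[OF bx f(1)]]) (use x_f in auto)
  ultimately have bij: "bij_betw ?f ?D ?D" using bij_betw_comp_iff2[OF bx] by blast
  show thesis
  proof (rule that[OF _ _ bij])
    show "?D \<noteq> {}" using D by blast
    show "?f p \<noteq> p" "{mate M (x p), x (?f p)} \<in> E" if "p \<in> ?D" for p
      using x_f[OF that] that f(2,3)[of "x p"] by (fastforce, simp)
  qed blast
qed

text \<open>Marked vertices in consecutive odd columns with different shifts have no common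
  neighbour. The shifts alternate cyclically, except that columns 0 and 1 agree when \<open>m\<close> is odd.\<close>

definition column_shift :: "nat \<Rightarrow> nat \<Rightarrow> nat" where
  "column_shift m c = (if c = 0 \<or> even (m + c) then 0 else 1)"

text \<open>For \<open>k < n\<close> the rows are 1, 3, ..., \<open>2*n-1\<close> or 2, 4, ...,
  \<open>2*n\<close>. Two cyclically adjacent rows stay unmarked, so no two marked vertices of a
  column have a common neighbour across the wrap-around.\<close>

definition marked :: "nat \<Rightarrow> nat \<times> nat \<Rightarrow> nat \<times> nat" where
  "marked m = (\<lambda>(c, k). (2*c+1, 2*k+1 + column_shift m c))"

lemma column_shift_le: "column_shift m c \<le> 1"
  by (simp add: column_shift_def)

lemma marked_inj: "inj (marked m)"
  by (auto simp: marked_def inj_on_def)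

lemma marked_in_torus: "marked m ` ({..<m} \<times> {..<n}) \<subseteq> torus_V n m"
proof -
  have "2*k+1 + column_shift m c < 2*n+1" if "k < n" for c k
    using column_shift_le[of m c] that by linarith
  then show ?thesis by (auto simp: marked_def torus_V_def)
qed

text \<open>Marked columns are odd, rows within one column have equal parity, and row 0 is never
  marked.\<close>

lemma marked_independent:
  assumes "k < n" "k' < n"
  shows "{marked m (c, k), marked m (c', k')} \<notin> torus_E n m"
proof
  assume "{marked m (c, k), marked m (c', k')} \<in> torus_E n m"
  note t = torus_neighbourD[OF this[unfolded marked_def prod.case]]
  have "c = c'" using t(5) by presburger
  then have "2*k' = 2*k+1 \<or> 2*k = 2*k'+1" using t(5) by auto
  then show False by presburger
qed

text \<open>A common neighbour \<open>w\<close> in an odd column gives a vertical step. Otherwise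
  \<open>w\<close> shares its row with both marked vertices, so their columns have equal shifts;
  among neighbouring odd columns only \<open>c = 0\<close> and \<open>c = 1\<close> do, for odd
  \<open>m\<close>.\<close>

lemma marked_step:
  assumes "m \<ge> 2" "c < m" "k < n" "c' < m" "k' < n" "(c, k) \<noteq> (c', k')"
    and e1: "{marked m (c, k), w} \<in> torus_E n m" and e2: "{w, marked m (c', k')} \<in> torus_E n m"
  shows "c' = c \<and> k' = k + 1 \<and> w = (2*c+1, 2*k+2 + column_shift m c) \<or>
         c' = c \<and> k = k' + 1 \<and> w = (2*c+1, 2*k'+2 + column_shift m c) \<or>
         odd m \<and> (c = 0 \<and> c' = 1 \<or> c = 1 \<and> c' = 0) \<and> k' = k \<and> w = (2, 2*k+1)"
proof -
  obtain i j where w: "w = (i, j)" by (cases w)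
  note t = torus_neighbourD[OF e1[unfolded marked_def prod.case w]]
  note t' = torus_neighbourD[OF e2[unfolded marked_def prod.case w]]
  note s = column_shift_le[of m c] column_shift_le[of m c']
  show ?thesis
  proof (cases "i = 2*c+1")
    case True
    then have "c' = c" using t'(5) assms(2,4) by presburger
    have "k' = k + 1 \<and> j = 2*k+2 + column_shift m c \<or> k = k' + 1 \<and> j = 2*k'+2 + column_shift m c"
      using True t(5) t'(5) s(1) assms(3,5,6) unfolding \<open>c' = c\<close> by (auto; presburger)
    then show ?thesis using True \<open>c' = c\<close> unfolding w by auto
  next
    case False
    then have j: "j = 2*k+1 + column_shift m c" using t(5) by linarith
    have "c \<noteq> c' \<or> k \<noteq> k'" using assms(6) by auto
    then have i: "i \<noteq> 2*c'+1" using False t(5) by presburger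
    then have j': "j = 2*k'+1 + column_shift m c'" using t'(5) by linarith
    have eq: "k = k'" "column_shift m c = column_shift m c'" using j j' s by presburger+
    then have "c \<noteq> c'" using assms(6) by auto
    then have adj: "c' = c + 1 \<and> i = 2*c+2 \<or> c = c' + 1 \<and> i = 2*c'+2 \<or>
                    c = 0 \<and> c' + 1 = m \<or> c' = 0 \<and> c + 1 = m"
    proof -
      have "i = 2*c+2 \<or> i = 2*c \<or> c + 1 = m \<and> i = 0" using t(5) False by auto
      moreover have "i = 2*c'+2 \<or> i = 2*c' \<or> c' + 1 = m \<and> i = 0" using t'(5) i by auto
      ultimately show ?thesis using \<open>c \<noteq> c'\<close> by auto
    qed
    have shift: "c = 0 \<and> odd m" if "column_shift m c = column_shift m (c+1)" for c
      using that by (auto simp: column_shift_def split: if_splits)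
    \<comment> \<open>The pair across the wrap-around always has different shifts.\<close>
    have last: "column_shift m d \<noteq> column_shift m 0" if "d + 1 = m" for d
      using that assms(1) by (auto simp: column_shift_def)
    show ?thesis using adj
    proof (elim disjE conjE)
      assume c: "c' = c + 1" "i = 2*c+2"
      then have "c = 0" "odd m" using shift[of c] eq by simp_all
      then show ?thesis using c eq j unfolding w by (simp add: column_shift_def)
    next
      assume c: "c = c' + 1" "i = 2*c'+2"
      then have "c' = 0" "odd m" using shift[of c'] eq by simp_all
      then show ?thesis using c eq j' unfolding w by (simp add: column_shift_def)
    next
      assume "c = 0" "c' + 1 = m"
      then show ?thesis using last[of c'] eq by simp
    next
      assume "c' = 0" "c + 1 = m"
      then show ?thesis using last[of c] eq by simp
    qed
  qed
qed

lemma forcing_set_avoiding_marked: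
  assumes nm: "n \<ge> 1" "m \<ge> 2" and pm: "perfect_matching (torus_V n m) (torus_E n m) M"
  shows "forcing_set (torus_V n m) (torus_E n m) M
    {e \<in> M. e \<inter> marked m ` ({..<m} \<times> {..<n}) = {}}"
proof (rule ccontr)
  let ?V = "torus_V n m" and ?E = "torus_E n m" and ?I = "{..<m} \<times> {..<n}"
  note sg = simple_graph_torus[OF nm]
  assume "\<not> forcing_set ?V ?E M {e \<in> M. e \<inter> marked m ` ?I = {}}"
  then obtain D f where D: "D \<noteq> {}" "D \<subseteq> ?I" and bij: "bij_betw f D D"
    and fne: "\<And>p. p \<in> D \<Longrightarrow> f p \<noteq> p"
    and fE: "\<And>p. p \<in> D \<Longrightarrow> {mate M (marked m p), marked m (f p)} \<in> ?E"
  proof (rule not_forcing_permutation_indexed[OF sg pm _ marked_in_torus, rotated 2])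
    show "inj_on (marked m) ?I" using marked_inj by (rule inj_on_subset) simp
  qed (use marked_independent in auto)
  have finD: "finite D" using D(2) by (rule finite_subset) simp
  \<comment> \<open>\<open>w p\<close> is the vertex between \<open>p\<close> and \<open>f p\<close>
    on the alternating cycle; distinct steps use distinct such vertices.\<close>
  define w where "w p = mate M (marked m p)" for p
  have fD: "f p \<in> D" if "p \<in> D" for p using that bij by (auto simp: bij_betw_def)
  have markedV: "marked m p \<in> ?V" if "p \<in> D" for p using that D(2) marked_in_torus by blast
  have mate_w: "mate M (w p) = marked m p" if "p \<in> D" for p
    unfolding w_def using mate_props(3)[OF sg pm markedV[OF that]] .
  have w_inj: "p = q" if "p \<in> D" "q \<in> D" "w p = w q" for p q
    using mate_w that marked_inj by (metis injD)
  have step: "d = c \<and> l = k + 1 \<and> w (c, k) = (2*c+1, 2*k+2 + column_shift m c) \<or>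
      d = c \<and> k = l + 1 \<and> w (c, k) = (2*c+1, 2*l+2 + column_shift m c) \<or>
      odd m \<and> (c = 0 \<and> d = 1 \<or> c = 1 \<and> d = 0) \<and> l = k \<and> w (c, k) = (2, 2*k+1)"
    if p: "(c, k) \<in> D" and q: "f (c, k) = (d, l)" for c k d l
  proof (rule marked_step)
    show "{marked m (c, k), w (c, k)} \<in> ?E"
      unfolding w_def using mate_props(4)[OF sg pm markedV[OF p]] .
    show "{w (c, k), marked m (d, l)} \<in> ?E" using fE[OF p] q unfolding w_def by simp
    show "(c, k) \<noteq> (d, l)" using fne[OF p] q by metis
    show "c < m" "k < n" "d < m" "l < n" using p fD[OF p] q D(2) by auto
  qed (rule nm)
  \<comment> \<open>A step up crosses the cut above height \<open>k\<close>, so some step crosses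
    back down. In the same column it would reuse the vertex \<open>w (c, k)\<close>, so it lies in
    the partner column.\<close>
  have cross_up: "odd m \<and> c \<le> 1 \<and> (1 - c, k + 1) \<in> D \<and> f (1 - c, k + 1) = (1 - c, k)"
    if p: "(c, k) \<in> D" "f (c, k) = (c, k + 1)" for c k
  proof -
    \<comment> \<open>The partner column is included whenever horizontal steps can leave column
      \<open>c\<close>, so that these steps do not cross the cut.\<close>
    define P where "P q \<longleftrightarrow> k < snd q \<and> (fst q = c \<or> odd m \<and> c \<le> 1 \<and> fst q \<le> 1)"
      for q :: "nat \<times> nat"
    have "\<not> P (c, k)" "P (f (c, k))" using p(2) by (auto simp: P_def)
    then obtain y where "y \<in> D" "P y" "\<not> P (f y)"
      using cut_crossed_back[OF finD bij p(1), of P] by blast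
    then have y: "y \<in> D" "k < snd y" "fst y = c \<or> odd m \<and> c \<le> 1 \<and> fst y \<le> 1"
      "\<not> (k < snd (f y) \<and> (fst (f y) = c \<or> odd m \<and> c \<le> 1 \<and> fst (f y) \<le> 1))"
      unfolding P_def by blast+
    obtain d l e k' where yy: "y = (d, l)" "f y = (e, k')" by (metis surj_pair)
    note yf = yy(2)[unfolded yy(1)]
    have s: "e = d" "l = k + 1" "k' = k" "w y = (2*d+1, 2*k+2 + column_shift m d)"
      using step[OF y(1)[unfolded yy(1)] yf] y(2-4) unfolding yy yf fst_conv snd_conv
      by auto
    have "d \<noteq> c" using s(2,4) w_inj[OF y(1) p(1)] step[OF p] yy by auto
    then have "odd m" "c \<le> 1" "d = 1 - c" using y(3) yy by auto
    then show ?thesis using y(1) yy s by simp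
  qed
  \<comment> \<open>The mirror image, with the part below the cut.\<close>
  have cross_down: "odd m \<and> c \<le> 1 \<and> (1 - c, k) \<in> D \<and> f (1 - c, k) = (1 - c, k + 1)"
    if p: "(c, k + 1) \<in> D" "f (c, k + 1) = (c, k)" for c k
  proof -
    define P where "P q \<longleftrightarrow> snd q \<le> k \<and> (fst q = c \<or> odd m \<and> c \<le> 1 \<and> fst q \<le> 1)"
      for q :: "nat \<times> nat"
    have "\<not> P (c, k + 1)" "P (f (c, k + 1))" using p(2) by (auto simp: P_def)
    then obtain y where "y \<in> D" "P y" "\<not> P (f y)"
      using cut_crossed_back[OF finD bij p(1), of P] by blast
    then have y: "y \<in> D" "snd y \<le> k" "fst y = c \<or> odd m \<and> c \<le> 1 \<and> fst y \<le> 1"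
      "\<not> (snd (f y) \<le> k \<and> (fst (f y) = c \<or> odd m \<and> c \<le> 1 \<and> fst (f y) \<le> 1))"
      unfolding P_def by blast+
    obtain d l e k' where yy: "y = (d, l)" "f y = (e, k')" by (metis surj_pair)
    note yf = yy(2)[unfolded yy(1)]
    have s: "e = d" "l = k" "k' = k + 1" "w y = (2*d+1, 2*k+2 + column_shift m d)"
      using step[OF y(1)[unfolded yy(1)] yf] y(2-4) unfolding yy yf fst_conv snd_conv
      by auto
    have "d \<noteq> c" using s(2,4) w_inj[OF y(1) p(1)] step[OF p] yy by auto
    then have "odd m" "c \<le> 1" "d = 1 - c" using y(3) yy by auto
    then show ?thesis using y(1) yy s by simp
  qed
  have vertical: "\<exists>c k. (c, k) \<in> D \<and> f (c, k) = (c, k + 1)"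
    if p: "(d, l) \<in> D" "f (d, l) = (d, l')" for d l l'
    using step[OF p] p cross_down[of d l'] by auto
  have "\<exists>c k. (c, k) \<in> D \<and> f (c, k) = (c, k + 1)"
  proof -
    obtain d l where p: "(d, l) \<in> D" using D(1) by auto
    obtain d' l' where q: "f (d, l) = (d', l')" by (metis surj_pair)
    obtain d'' l'' where r: "f (d', l') = (d'', l'')" by (metis surj_pair)
    have q': "(d', l') \<in> D" using fD[OF p] q by simp
    show ?thesis
    \<comment> \<open>Two horizontal steps in a row would both pass through
      \<open>(2, 2*l+1)\<close>.\<close>
    proof (cases "d' = d \<or> d'' = d'")
      case True
      then show ?thesis using vertical p q q' r by blast
    next
      case False
      then have "w (d, l) = w (d', l')" using step[OF p q] step[OF q' r] by auto
      then show ?thesis using w_inj[OF p q'] fne[OF p] q by simp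
    qed
  qed
  then obtain c where ex: "\<exists>k. (c, k) \<in> D \<and> f (c, k) = (c, k + 1)" by blast
  \<comment> \<open>The lowest step up in column \<open>c\<close>; below it the cycle cannot descend
    in the partner column \<open>c'\<close>.\<close>
  define a where "a = (LEAST k. (c, k) \<in> D \<and> f (c, k) = (c, k + 1))"
  have a: "(c, a) \<in> D" "f (c, a) = (c, a + 1)"
    using LeastI_ex[OF ex] unfolding a_def by blast+
  define c' where "c' = 1 - c"
  have m: "odd m" "m \<ge> 3" and c: "c \<le> 1" using cross_up[OF a] nm(2) by (auto elim: oddE)
  have c': "c' \<le> 1" "1 - c' = c" "c \<noteq> c'" using c unfolding c'_def by presburger+
  have shift0: "column_shift m d = 0" if "d \<le> 1" for d
    using that m by (cases "d = 0") (auto simp: column_shift_def)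
  \<comment> \<open>The path between the two columns enters \<open>(2, 2a+1)\<close> from below and would have to be
    matched upwards in consecutive pairs, so the alternating cycle never gets to close up.\<close>
  have start: "mate M (2, 2*a+1) \<noteq> (2, 2*a+2)"
  proof -
    have p: "(c', a+1) \<in> D" "f (c', a+1) = (c', a)" using cross_up[OF a] unfolding c'_def by auto
    have q: "(c', a) \<in> D" using fD[OF p(1)] p(2) by simp
    obtain e k where r: "f (c', a) = (e, k)" by (metis surj_pair)
    \<comment> \<open>Turning back up would reuse the vertex passed on the way down.\<close>
    have "\<not> (e = c' \<and> k = a + 1)"
      using step[OF p] step[OF q r] w_inj[OF p(1) q] by auto
    moreover have "\<not> (e = c' \<and> a = k + 1)"
    proof
      assume "e = c' \<and> a = k + 1"
      then have "(c, k) \<in> D \<and> f (c, k) = (c, k + 1)" using cross_down[of c' k] q r c'(2) by simp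
      then have "a \<le> k" unfolding a_def by (rule Least_le)
      then show False using \<open>e = c' \<and> a = k + 1\<close> by simp
    qed
    ultimately have "w (c', a) = (2, 2*a+1)" using step[OF q r] by auto
    then have "mate M (2, 2*a+1) = (2*c'+1, 2*a+1 + column_shift m c')"
      using mate_w[OF q] by (simp add: marked_def)
    then show ?thesis by auto
  qed
  \<comment> \<open>The matching of the column in between blocks every crossing, so the step up at
    height \<open>a\<close> is followed by steps up without end.\<close>
  have climb: "(c, a+t) \<in> D \<and> f (c, a+t) = (c, a+t+1) \<and> mate M (2, 2*(a+t)+1) \<noteq> (2, 2*(a+t)+2)" for t
  proof (induction t)
    case 0
    show ?case using a start by simp
  next
    case (Suc t)
    let ?k = "a + t"
    have p: "(c, ?k) \<in> D" "f (c, ?k) = (c, ?k+1)" and ne: "mate M (2, 2*?k+1) \<noteq> (2, 2*?k+2)"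
      using Suc by auto
    have p': "(c, ?k+1) \<in> D" using fD[OF p(1)] p(2) by simp
    have q: "(c', ?k+1) \<in> D" "f (c', ?k+1) = (c', ?k)" using cross_up[OF p] unfolding c'_def by auto
    have wp: "w (c, ?k) = (2*c+1, 2*?k+2)" using step[OF p] shift0[OF c] by auto
    have wq: "w (c', ?k+1) = (2*c'+1, 2*?k+2)" using step[OF q] shift0[OF c'(1)] by auto
    have kn: "?k + 1 < n" using p' D(2) by auto
    have V: "(2, 2*?k+2) \<in> ?V" "(2, 2*?k+1) \<in> ?V" using kn m by (auto simp: torus_V_def)
    obtain i j where ij: "mate M (2, 2*?k+2) = (i, j)" by (metis surj_pair)
    have mate_ij: "mate M (i, j) = (2, 2*?k+2)" using mate_props(3)[OF sg pm V(1)] ij by simp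
    \<comment> \<open>Both horizontal neighbours of \<open>(2, 2*?k+2)\<close> are matched to marked
      vertices, and the one below is excluded by the induction hypothesis; only the one above
      remains.\<close>
    have "(i, j) \<noteq> w (c, ?k)" using mate_w[OF p(1)] mate_ij by (auto simp: marked_def)
    moreover have "(i, j) \<noteq> w (c', ?k+1)" using mate_w[OF q(1)] mate_ij by (auto simp: marked_def)
    moreover have "(i, j) \<noteq> (2, 2*?k+1)" using ne mate_ij by auto
    moreover have "{(2, 2*?k+2), (i, j)} \<in> ?E" using mate_props(4)[OF sg pm V(1)] ij by simp
    then have "j = 2*?k+2 \<and> (i = 1 \<or> i = 3) \<or> i = 2 \<and> (j = 2*?k+1 \<or> j = 2*?k+3)"
      using torus_neighbourD(5) kn m(2) by fastforce
    moreover have "{c, c'} = {0, 1}" using c unfolding c'_def by auto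
    ultimately have up: "(i, j) = (2, 2*?k+3)"
      using wp wq by (auto simp: doubleton_eq_iff)
    obtain e l where r: "f (c, ?k+1) = (e, l)" by (metis surj_pair)
    \<comment> \<open>Crossing is impossible as \<open>(2, 2*?k+3)\<close> is taken, and stepping
      down would reuse \<open>w (c, ?k)\<close>.\<close>
    have "w (c, ?k+1) \<noteq> (2, 2*(?k+1)+1)"
      using mate_w[OF p'] mate_ij up by (auto simp: marked_def numeral_3_eq_3)
    moreover have "w (c, ?k+1) \<noteq> (2*c+1, 2*?k+2)" using w_inj[OF p' p(1)] wp by auto
    ultimately have "f (c, ?k+1) = (c, ?k+2)" using step[OF p' r] r shift0[OF c] by auto
    then show ?case using p' mate_ij up by (simp add: numeral_3_eq_3)
  qed
  \<comment> \<open>After \<open>n\<close> steps the height exceeds every index below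
    \<open>n\<close>.\<close>
  then have "(c, a + n) \<in> D" by blast
  then show False using D(2) by auto
qed

section \<open>The count and the maximum\<close>

text \<open>Of the \<open>(2*n+1) * m\<close> edges of \<open>M\<close>, exactly
  \<open>m * n\<close> meet marked vertices.\<close>

lemma forcing_number_torus_le:
  assumes nm: "n \<ge> 1" "m \<ge> 2" and pm: "perfect_matching (torus_V n m) (torus_E n m) M"
  shows "forcing_number (torus_V n m) (torus_E n m) M \<le> (n + 1) * m"
proof -
  let ?X = "marked m ` ({..<m} \<times> {..<n})"
  note sg = simple_graph_torus[OF nm]
  have "card ?X = m * n"
    using card_image[OF inj_on_subset[OF marked_inj], of "{..<m} \<times> {..<n}" m] by simp
  moreover have "card {e \<in> M. e \<inter> ?X = {}} + card ?X = card M"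
    by (rule card_matching_avoiding[OF sg pm marked_in_torus]) (use marked_independent in auto)
  moreover have "card M = (2*n+1) * m"
    using card_perfect_matching[OF sg pm] by (simp add: card_torus_V)
  ultimately have "card {e \<in> M. e \<inter> ?X = {}} = (n + 1) * m" by (simp add: algebra_simps)
  then show ?thesis using forcing_number_le[OF forcing_set_avoiding_marked[OF assms]] by simp
qed

theorem theorem5p2:
  fixes n m :: nat
  assumes "n \<ge> 1" and "m \<ge> 2"
  shows "max_forcing_number (torus_V n m) (torus_E n m) = (n + 1) * m"
  unfolding max_forcing_number_def
proof (rule Max_eqI)
  have "{M. perfect_matching (torus_V n m) (torus_E n m) M} \<subseteq> Pow (torus_E n m)"
    unfolding perfect_matching_def by blast
  then have "finite {M. perfect_matching (torus_V n m) (torus_E n m) M}"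
    using finite_edges[OF simple_graph_torus[OF assms]] finite_subset by blast
  then show "finite {forcing_number (torus_V n m) (torus_E n m) M |M.
      perfect_matching (torus_V n m) (torus_E n m) M}"
    by simp
  show "k \<le> (n + 1) * m" if "k \<in> {forcing_number (torus_V n m) (torus_E n m) M |M.
      perfect_matching (torus_V n m) (torus_E n m) M}" for k
    using that forcing_number_torus_le[OF assms] by blast
  show "(n + 1) * m \<in> {forcing_number (torus_V n m) (torus_E n m) M |M.
      perfect_matching (torus_V n m) (torus_E n m) M}"
    using forcing_number_torus_le[OF assms perfect_matching_horizontal]
      forcing_number_horizontal_ge[OF assms] perfect_matching_horizontal
    by (metis (mono_tags, lifting) le_antisym mem_Collect_eq)
qed

end
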